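(* Let $X$ be a graph. If $X$ is class I, then its complete generalized truncation is class I. If $X$ is class II and its maximum valency is even, then its complete generalized truncation is class I.
   Context: Generalized truncation of a graph $X$ (without isolated vertices): take a matching $M_0$ with $|M_0|=|E(X)|$ (on $2|E(X)|$ new vertices) and a bijection $F:E(X)\to M_0$; for each edge $e$ of $X$ with ends $u,v$, label one end of $F(e)$ by $u$ and the other by $v$. For $v\in V(X)$, the cluster $\mathrm{cl}(v)$ is the set of vertices labelled $v$; insert a graph $\mathrm{con}(v)$ (constituent) on $\mathrm{cl}(v)$. The result is a generalized truncation; it is the complete generalized truncation if every constituent is a complete graph. A graph is class I if its chromatic index (minimum number of colors in a proper edge coloring) equals its maximum valency, and class II otherwise. *)

theory Defs
  imports Main
begin

record 'a ugraph =
  verts :: "'a set"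
  edges :: "'a set set"

definition simple_graph :: "'a ugraph \<Rightarrow> bool" where
  "simple_graph G \<longleftrightarrow> (\<forall>e\<in>edges G. e \<subseteq> verts G \<and> card e = 2)"

definition finite_simple_graph :: "'a ugraph \<Rightarrow> bool" where
  "finite_simple_graph G \<longleftrightarrow> simple_graph G \<and> finite (verts G)"

definition complete_graph :: "'a ugraph \<Rightarrow> bool" where
  "complete_graph G \<longleftrightarrow>
     simple_graph G \<and> (\<forall>u\<in>verts G. \<forall>v\<in>verts G. u \<noteq> v \<longrightarrow> {u, v} \<in> edges G)"

definition valency :: "'a ugraph \<Rightarrow> 'a \<Rightarrow> nat" where
  "valency G v = card {e \<in> edges G. v \<in> e}"

definition isolated_vertex :: "'a ugraph \<Rightarrow> 'a \<Rightarrow> bool" where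
  "isolated_vertex G v \<longleftrightarrow> v \<in> verts G \<and> (\<forall>e\<in>edges G. v \<notin> e)"

text \<open>On \<^typ>\<open>nat\<close> the supremum of the empty set is \<open>0\<close>, so the graph without vertices
  has maximum valency \<open>0\<close>.\<close>

definition max_valency :: "'a ugraph \<Rightarrow> nat" where
  "max_valency G = (SUP v\<in>verts G. valency G v)"

definition proper_edge_coloring :: "'a ugraph \<Rightarrow> ('a set \<Rightarrow> nat) \<Rightarrow> bool" where
  "proper_edge_coloring G c \<longleftrightarrow>
     (\<forall>e\<in>edges G. \<forall>f\<in>edges G. e \<noteq> f \<and> e \<inter> f \<noteq> {} \<longrightarrow> c e \<noteq> c f)"

definition chromatic_index :: "'a ugraph \<Rightarrow> nat" where
  "chromatic_index G = (LEAST k. \<exists>c. proper_edge_coloring G c \<and> c ` edges G \<subseteq> {..<k})"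

definition class_I :: "'a ugraph \<Rightarrow> bool" where
  "class_I G \<longleftrightarrow> chromatic_index G = max_valency G"

definition class_II :: "'a ugraph \<Rightarrow> bool" where
  "class_II G \<longleftrightarrow> \<not> class_I G"

definition cluster :: "'b set set \<Rightarrow> ('b \<Rightarrow> 'a) \<Rightarrow> 'a \<Rightarrow> 'b set" where
  "cluster M lab v = {x \<in> \<Union>M. lab x = v}"

text \<open>The vertices of the truncation are the ends of the edges of the matching \<open>M\<close>. The
  labelling sends the two ends of \<open>F e\<close> bijectively to the two ends of \<open>e\<close>. The equality
  of the numbers of edges of \<open>M\<close> and \<open>X\<close> is part of the bijectivity of \<open>F\<close>.\<close>

definition truncation_data ::
    "'a ugraph \<Rightarrow> 'b set set \<Rightarrow> ('a set \<Rightarrow> 'b set) \<Rightarrow> ('b \<Rightarrow> 'a) \<Rightarrow> ('a \<Rightarrow> 'b ugraph)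
      \<Rightarrow> 'b ugraph \<Rightarrow> bool" where
  "truncation_data X M F lab con Y \<longleftrightarrow>
     (\<forall>m\<in>M. card m = 2) \<and> pairwise disjnt M \<and>
     bij_betw F (edges X) M \<and>
     (\<forall>e\<in>edges X. bij_betw lab (F e) e) \<and>
     (\<forall>v\<in>verts X. simple_graph (con v) \<and> verts (con v) = cluster M lab v) \<and>
     Y = \<lparr>verts = \<Union>M, edges = M \<union> (\<Union>v\<in>verts X. edges (con v))\<rparr>"

definition generalized_truncation :: "'a ugraph \<Rightarrow> 'b ugraph \<Rightarrow> bool" where
  "generalized_truncation X Y \<longleftrightarrow> (\<exists>M F lab con. truncation_data X M F lab con Y)"

definition complete_generalized_truncation :: "'a ugraph \<Rightarrow> 'b ugraph \<Rightarrow> bool" where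
  "complete_generalized_truncation X Y \<longleftrightarrow>
     (\<exists>M F lab con. truncation_data X M F lab con Y \<and>
        (\<forall>v\<in>verts X. complete_graph (con v)))"

lemma complete_generalized_truncation_exists:
  fixes X :: "'a ugraph"
  assumes "simple_graph X"
  shows "\<exists>Y :: ('a \<times> 'a set) ugraph. complete_generalized_truncation X Y"
proof -
  define F :: "'a set \<Rightarrow> ('a \<times> 'a set) set" where "F = (\<lambda>e. (\<lambda>v. (v, e)) ` e)"
  define M where "M = F ` edges X"
  define con where "con = (\<lambda>v. \<lparr>verts = cluster M fst v,
      edges = {e. e \<subseteq> cluster M fst v \<and> card e = 2}\<rparr>)"
  have two: "card e = 2" if "e \<in> edges X" for e
    using assms that by (auto simp: simple_graph_def)
  have ne: "e \<noteq> {}" if "e \<in> edges X" for e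
    using two[OF that] by auto
  have "card m = 2" if "m \<in> M" for m
    using that two by (auto simp: M_def F_def card_image inj_on_def)
  moreover have "pairwise disjnt M"
    by (auto simp: pairwise_def disjnt_iff M_def F_def)
  moreover have "bij_betw F (edges X) M"
  proof -
    have "inj_on F (edges X)"
    proof (rule inj_onI)
      fix e f assume "e \<in> edges X" "f \<in> edges X" "F e = F f"
      moreover obtain v where "v \<in> e" using ne[OF \<open>e \<in> edges X\<close>] by blast
      ultimately have "(v, e) \<in> F f" by (auto simp: F_def)
      then show "e = f" by (auto simp: F_def)
    qed
    then show ?thesis by (simp add: bij_betw_def M_def)
  qed
  moreover have "bij_betw fst (F e) e" for e
    by (simp add: bij_betw_def inj_on_def F_def image_image)
  moreover have con: "complete_graph (con v)" "simple_graph (con v)"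
      "verts (con v) = cluster M fst v" for v
    by (simp_all add: complete_graph_def simple_graph_def con_def)
  ultimately have "truncation_data X M F fst con
      \<lparr>verts = \<Union>M, edges = M \<union> (\<Union>v\<in>verts X. edges (con v))\<rparr>"
    by (simp add: truncation_data_def)
  with con(1) show ?thesis
    unfolding complete_generalized_truncation_def by (intro exI conjI ballI)
qed

end

theory Submission
  imports Defs "HOL-Number_Theory.Cong"
begin

text \<open>
  Every vertex \<open>x\<close> of the truncation \<open>Y\<close> with label \<open>v\<close> has the valency of \<open>v\<close>, so \<open>X\<close> and
  \<open>Y\<close> have the same maximum valency \<open>d\<close> and it suffices to colour \<open>Y\<close> with \<open>d\<close> colours.
  Give each vertex an index \<open>g x < d\<close> such that \<open>g\<close> is injective on clusters.

  If \<open>X\<close> has a proper edge colouring with \<open>d\<close> colours, the index of a vertex on \<open>F e\<close> can be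
  taken to be the colour of \<open>e\<close>. Then the colour \<open>(g x + g y) mod d\<close> of an edge \<open>{x, y}\<close> is
  proper: at \<open>x\<close>, the matching edge has colour \<open>2 * g x\<close>, and the other edges have the
  colours \<open>g x + g y\<close> with distinct \<open>g y \<noteq> g x\<close>.

  If \<open>d\<close> is even, all matching edges get the same colour, and the remaining \<open>d - 1\<close> colours
  suffice for the constituents by the usual 1-factorization of the complete graph with \<open>d\<close>
  vertices.
\<close>

section \<open>Valency, edge colourings and class I in general graphs\<close>

lemma finite_edges:
  assumes "finite_simple_graph G"
  shows "finite (edges G)"
proof -
  have "edges G \<subseteq> Pow (verts G)"
    using assms by (auto simp: finite_simple_graph_def simple_graph_def)
  then show ?thesis
    using assms by (auto simp: finite_simple_graph_def intro: finite_subset)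
qed

lemma valency_le_max_valency:
  assumes "finite (verts G)" "v \<in> verts G"
  shows "valency G v \<le> max_valency G"
  unfolding max_valency_def using assms by (intro cSUP_upper) auto

lemma max_valency_attained:
  assumes "finite (verts G)" "verts G \<noteq> {}"
  obtains v where "v \<in> verts G" "valency G v = max_valency G"
proof -
  have "max_valency G = Max (valency G ` verts G)"
    unfolding max_valency_def using assms by (intro cSup_eq_Max) auto
  then have "max_valency G \<in> valency G ` verts G"
    using assms by (simp only:) (intro Max_in, auto)
  then show ?thesis using that by auto
qed

lemma valency_le_colors:
  assumes "proper_edge_coloring G c" "c ` edges G \<subseteq> {..<k}"
  shows "valency G v \<le> k"
proof -
  have "inj_on c {e \<in> edges G. v \<in> e}"
    using assms(1) unfolding proper_edge_coloring_def inj_on_def by blast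
  moreover have "c ` {e \<in> edges G. v \<in> e} \<subseteq> {..<k}"
    using assms(2) by blast
  ultimately show ?thesis
    unfolding valency_def using card_inj_on_le[of c _ "{..<k}"] by simp
qed

lemma max_valency_le_colors:
  assumes "proper_edge_coloring G c" "c ` edges G \<subseteq> {..<k}"
  shows "max_valency G \<le> k"
proof (cases "verts G = {}")
  case True
  then show ?thesis by (simp add: max_valency_def)
next
  case False
  then show ?thesis
    unfolding max_valency_def by (intro cSUP_least valency_le_colors[OF assms])
qed

text \<open>The edges at one vertex need distinct colours, so no proper colouring uses fewer than
  \<open>max_valency G\<close> colours. One colouring that meets this bound therefore settles the
  chromatic index.\<close>

lemma class_I_if_coloring:
  assumes "proper_edge_coloring G c" "c ` edges G \<subseteq> {..<k}" "k \<le> max_valency G"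
  shows "class_I G"
proof -
  have "k = max_valency G"
    using assms max_valency_le_colors by (metis le_antisym)
  then show ?thesis
    unfolding class_I_def chromatic_index_def
    using assms(1,2) max_valency_le_colors by (intro Least_equality) blast+
qed

text \<open>Giving all edges different colours shows that some number of colours suffices, so the
  \<open>LEAST\<close> in \<open>chromatic_index\<close> is attained.\<close>

lemma finite_proper_edge_coloring_exists:
  assumes "finite (edges G)"
  shows "\<exists>k c. proper_edge_coloring G c \<and> c ` edges G \<subseteq> {..<k}"
proof -
  obtain c :: "'a set \<Rightarrow> nat" and k where "c ` edges G = {i. i < k}" "inj_on c (edges G)"
    using finite_imp_inj_to_nat_seg[OF assms] by blast
  then have "proper_edge_coloring G c \<and> c ` edges G \<subseteq> {..<k}"
    unfolding proper_edge_coloring_def by (auto dest: inj_onD)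
  then show ?thesis by blast
qed

lemma class_I_coloring:
  assumes "finite (edges G)" "class_I G"
  obtains c where "proper_edge_coloring G c" "c ` edges G \<subseteq> {..<max_valency G}"
proof -
  have "\<exists>c. proper_edge_coloring G c \<and> c ` edges G \<subseteq> {..<chromatic_index G}"
    unfolding chromatic_index_def
    using finite_proper_edge_coloring_exists[OF assms(1)] by (rule LeastI_ex)
  then show ?thesis
    using assms(2) that by (auto simp: class_I_def)
qed

text \<open>Distinct edges that meet in \<open>x\<close> differ in their other ends. In this form,
  colours computed from the two ends of an edge can be compared by cancelling the contribution of
  \<open>x\<close>.\<close>

lemma proper_edge_coloringI:
  assumes "\<And>e. e \<in> edges G \<Longrightarrow> card e = 2"
    and "\<And>x y z. \<lbrakk>{x, y} \<in> edges G; {x, z} \<in> edges G; x \<noteq> y; x \<noteq> z; y \<noteq> z\<rbrakk>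
          \<Longrightarrow> c {x, y} \<noteq> c {x, z}"
  shows "proper_edge_coloring G c"
proof -
  have other_end: "\<exists>y. x \<noteq> y \<and> e = {x, y}" if "e \<in> edges G" "x \<in> e" for e x
    using assms(1)[OF that(1)] that(2) by (auto simp: card_2_iff)
  have "c e \<noteq> c f" if ef: "e \<in> edges G" "f \<in> edges G" "e \<noteq> f" and x: "x \<in> e" "x \<in> f" for e f x
  proof -
    obtain y z where "x \<noteq> y" "e = {x, y}" "x \<noteq> z" "f = {x, z}"
      using other_end[OF ef(1) x(1)] other_end[OF ef(2) x(2)] by blast
    with ef assms(2)[of x y z] show ?thesis by auto
  qed
  then show ?thesis
    unfolding proper_edge_coloring_def by blast
qed

lemma add_mod_cancel_left_nat:
  fixes a b c n :: nat
  assumes "(a + b) mod n = (a + c) mod n" "b < n" "c < n"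
  shows "b = c"
  using assms by (metis cong_def cong_add_lcancel_nat mod_less)

section \<open>Structure of the complete truncation: labels, clusters and matching edges\<close>

locale complete_truncation =
  fixes X :: "'a ugraph" and M :: "'b set set" and F :: "'a set \<Rightarrow> 'b set"
    and lab :: "'b \<Rightarrow> 'a" and con :: "'a \<Rightarrow> 'b ugraph" and Y :: "'b ugraph"
  assumes finite_simple: "finite_simple_graph X"
    and data: "truncation_data X M F lab con Y"
    and complete: "\<And>v. v \<in> verts X \<Longrightarrow> complete_graph (con v)"
begin

lemma edge_subset: "e \<in> edges X \<Longrightarrow> e \<subseteq> verts X"
  using finite_simple by (auto simp: finite_simple_graph_def simple_graph_def)

lemma finite_verts: "finite (verts X)"
  using finite_simple by (simp add: finite_simple_graph_def)

lemma card_matching: "m \<in> M \<Longrightarrow> card m = 2"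
  using data by (simp add: truncation_data_def)

lemma matching_disjoint: "\<lbrakk>m \<in> M; m' \<in> M; x \<in> m; x \<in> m'\<rbrakk> \<Longrightarrow> m = m'"
  using data unfolding truncation_data_def pairwise_def disjnt_iff by blast

lemma F_bij: "bij_betw F (edges X) M"
  using data by (simp add: truncation_data_def)

lemma F_in_matching: "e \<in> edges X \<Longrightarrow> F e \<in> M"
  using F_bij by (auto simp: bij_betw_def)

lemma matching_edgeE:
  assumes "m \<in> M"
  obtains e where "e \<in> edges X" "F e = m"
  using assms bij_betw_imp_surj_on[OF F_bij] by blast

lemma lab_bij: "e \<in> edges X \<Longrightarrow> bij_betw lab (F e) e"
  using data by (simp add: truncation_data_def)

lemma verts_con: "v \<in> verts X \<Longrightarrow> verts (con v) = cluster M lab v"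
  using data by (simp add: truncation_data_def)

lemma verts_Y: "verts Y = \<Union>M"
  using data by (simp add: truncation_data_def)

lemma edges_Y: "edges Y = M \<union> (\<Union>v\<in>verts X. edges (con v))"
  using data by (simp add: truncation_data_def)

text \<open>A vertex of \<open>Y\<close> stands for an incidence of \<open>X\<close>, namely of
  \<open>lab x\<close> with the edge \<open>source x\<close>. The description is unique because
  \<open>F\<close> is injective and the members of \<open>M\<close> are disjoint.\<close>

definition source :: "'b \<Rightarrow> 'a set" where
  "source x = (THE e. e \<in> edges X \<and> x \<in> F e)"

lemma source_eq:
  assumes "e \<in> edges X" "x \<in> F e"
  shows "source x = e"
  unfolding source_def
proof (rule the_equality)
  fix f assume f: "f \<in> edges X \<and> x \<in> F f"
  then have "F f = F e"
    using assms matching_disjoint F_in_matching by blast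
  then show "f = e"
    using f assms F_bij by (auto simp: bij_betw_def dest: inj_onD)
qed (use assms in auto)

lemma source:
  assumes "x \<in> \<Union>M"
  shows "source x \<in> edges X" "x \<in> F (source x)" "lab x \<in> source x"
proof -
  obtain e where e: "e \<in> edges X" "x \<in> F e"
    using assms F_bij by (auto simp: bij_betw_def)
  then show "source x \<in> edges X" "x \<in> F (source x)"
    by (simp_all add: source_eq)
  show "lab x \<in> source x"
    using e lab_bij[OF e(1)] by (auto simp: source_eq bij_betw_def)
qed

lemma source_inj:
  assumes "x \<in> \<Union>M" "y \<in> \<Union>M" "lab x = lab y" "source x = source y"
  shows "x = y"
  using assms source[of x] source[of y] lab_bij[of "source x"]
  by (auto simp: bij_betw_def dest: inj_onD)

text \<open>Each edge \<open>e\<close> at \<open>v\<close> puts exactly one end of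
  \<open>F e\<close> into the cluster of \<open>v\<close>. Hence cluster sizes are valencies of
  \<open>X\<close>.\<close>

lemma source_cluster_bij:
  "bij_betw source (cluster M lab v) {e \<in> edges X. v \<in> e}"
  unfolding bij_betw_def
proof
  show "inj_on source (cluster M lab v)"
    by (rule inj_onI) (auto simp: cluster_def intro: source_inj)
  show "source ` cluster M lab v = {e \<in> edges X. v \<in> e}"
  proof
    show "source ` cluster M lab v \<subseteq> {e \<in> edges X. v \<in> e}"
      using source by (auto simp: cluster_def)
    show "{e \<in> edges X. v \<in> e} \<subseteq> source ` cluster M lab v"
    proof
      fix e assume e: "e \<in> {e \<in> edges X. v \<in> e}"
      then have "v \<in> lab ` F e"
        using bij_betw_imp_surj_on[OF lab_bij[of e]] by simp
      then obtain x where x: "x \<in> F e" "lab x = v" by blast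
      then have "x \<in> cluster M lab v" "source x = e"
        using e F_in_matching source_eq by (auto simp: cluster_def)
      then show "e \<in> source ` cluster M lab v" by blast
    qed
  qed
qed

lemma card_cluster: "card (cluster M lab v) = valency X v"
  unfolding valency_def using source_cluster_bij by (rule bij_betw_same_card)

lemma finite_cluster: "finite (cluster M lab v)"
  using bij_betw_finite[OF source_cluster_bij[of v]] finite_edges[OF finite_simple] by simp

lemma matching_lab_neq:
  assumes "{x, y} \<in> M" "x \<noteq> y"
  shows "lab x \<noteq> lab y"
proof -
  obtain e where "e \<in> edges X" "F e = {x, y}"
    using matching_edgeE[OF assms(1)] .
  then show ?thesis
    using lab_bij[of e] assms(2) by (auto simp: bij_betw_def)
qed

lemma constituent_edge:
  assumes "{x, y} \<in> edges Y" "{x, y} \<notin> M"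
  shows "x \<in> \<Union>M" "y \<in> \<Union>M" "lab x = lab y"
proof -
  obtain v where v: "v \<in> verts X" "{x, y} \<in> edges (con v)"
    using assms edges_Y by auto
  then have "{x, y} \<subseteq> cluster M lab v"
    using complete[OF v(1)] verts_con[OF v(1)] by (auto simp: complete_graph_def simple_graph_def)
  then show "x \<in> \<Union>M" "y \<in> \<Union>M" "lab x = lab y"
    by (auto simp: cluster_def)
qed

lemma card_edge_Y: "e \<in> edges Y \<Longrightarrow> card e = 2"
  using complete card_matching by (auto simp: edges_Y complete_graph_def simple_graph_def)

lemma edge_Y_subset: "e \<in> edges Y \<Longrightarrow> e \<subseteq> \<Union>M"
  using complete verts_con by (fastforce simp: edges_Y complete_graph_def simple_graph_def cluster_def)

lemma finite_verts_Y: "finite (\<Union>M)"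
proof -
  have "finite M"
    using bij_betw_finite[OF F_bij] finite_edges[OF finite_simple] by simp
  moreover have "finite m" if "m \<in> M" for m
    using card_matching[OF that] by (simp add: card_ge_0_finite)
  ultimately show ?thesis by blast
qed

lemma finite_simple_Y: "finite_simple_graph Y"
  unfolding finite_simple_graph_def simple_graph_def
  using card_edge_Y edge_Y_subset finite_verts_Y verts_Y by auto

section \<open>Comparison of the maximum valencies of \<open>X\<close> and \<open>Y\<close>\<close>

lemma valency_Y_ge:
  assumes "v \<in> verts X" "x \<in> cluster M lab v"
  shows "valency X v \<le> valency Y x"
proof -
  \<comment> \<open>Within its cluster \<open>x\<close> has one neighbour fewer than the cluster has
    members. The free slot \<open>y = x\<close> is filled by the matching edge at
    \<open>x\<close>.\<close>
  define f where "f y = (if y = x then F (source x) else {x, y})" for y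
  have x: "x \<in> \<Union>M" "lab x = v"
    using assms by (auto simp: cluster_def)
  \<comment> \<open>A matching edge joins different clusters, so it is not one of the constituent
    edges at \<open>x\<close>.\<close>
  have neq: "F (source x) \<noteq> {x, y}" if "y \<in> cluster M lab v" "y \<noteq> x" for y
    using matching_lab_neq[of x y] F_in_matching[OF source(1)[OF x(1)]] that x
    by (auto simp: cluster_def)
  have "inj_on f (cluster M lab v)"
  proof (rule inj_onI)
    fix y z assume "y \<in> cluster M lab v" "z \<in> cluster M lab v" "f y = f z"
    then show "y = z"
      using neq[of y] neq[of z] by (auto simp: f_def doubleton_eq_iff split: if_splits)
  qed
  moreover have "f ` cluster M lab v \<subseteq> {e \<in> edges Y. x \<in> e}"
  proof
    fix e assume "e \<in> f ` cluster M lab v"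
    then obtain y where y: "y \<in> cluster M lab v" "e = f y" by blast
    show "e \<in> {e \<in> edges Y. x \<in> e}"
    proof (cases "y = x")
      case True
      then show ?thesis
        using y source[OF x(1)] F_in_matching by (auto simp: f_def edges_Y)
    next
      case False
      then have "{x, y} \<in> edges (con v)"
        using complete[OF assms(1)] verts_con[OF assms(1)] assms(2) y(1)
        by (auto simp: complete_graph_def)
      then show ?thesis
        using y False assms(1) by (auto simp: f_def edges_Y)
    qed
  qed
  moreover have "finite {e \<in> edges Y. x \<in> e}"
    using finite_edges[OF finite_simple_Y] by simp
  ultimately have "card (cluster M lab v) \<le> valency Y x"
    unfolding valency_def by (rule card_inj_on_le)
  then show ?thesis by (simp add: card_cluster)
qed

text \<open>If the maximum is positive, a vertex attaining it has a nonempty cluster, whose members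
  have at least that valency in \<open>Y\<close>. The converse inequality will follow from the
  colouring.\<close>

lemma max_valency_le: "max_valency X \<le> max_valency Y"
proof (cases "max_valency X = 0")
  case False
  then have "verts X \<noteq> {}" by (auto simp: max_valency_def)
  then obtain v where v: "v \<in> verts X" "valency X v = max_valency X"
    using max_valency_attained[OF finite_verts] by blast
  then have "cluster M lab v \<noteq> {}"
    using False card_cluster[of v] by auto
  then obtain x where x: "x \<in> cluster M lab v" by blast
  then have "valency Y x \<le> max_valency Y"
    using finite_verts_Y verts_Y by (intro valency_le_max_valency) (auto simp: cluster_def)
  then show ?thesis
    using valency_Y_ge[OF v(1) x] v(2) by simp
qed simp

lemma class_I_Y_of_coloring:
  assumes "proper_edge_coloring Y col" "col ` edges Y \<subseteq> {..<max_valency X}"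
  shows "class_I Y"
  using assms max_valency_le by (rule class_I_if_coloring)

section \<open>Colouring \<open>Y\<close> from an optimal colouring of \<open>X\<close>\<close>

lemma class_I_Y_if_class_I:
  assumes "class_I X"
  shows "class_I Y"
proof -
  obtain c where c: "proper_edge_coloring X c" "c ` edges X \<subseteq> {..<max_valency X}"
    using class_I_coloring[OF finite_edges[OF finite_simple] assms] .
  define g where "g x = c (source x)" for x
  define col where "col E = sum g E mod max_valency X" for E
  have g_less: "g x < max_valency X" if "x \<in> \<Union>M" for x
    using c(2) source(1)[OF that] by (auto simp: g_def)
  have g_inj: "g x \<noteq> g y" if "x \<in> \<Union>M" "y \<in> \<Union>M" "lab x = lab y" "x \<noteq> y" for x y
  proof -
    have "source x \<noteq> source y" using source_inj that by blast
    moreover have "lab x \<in> source x \<inter> source y"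
      using source(3)[OF that(1)] source(3)[OF that(2)] that(3) by simp
    ultimately show ?thesis
      using c(1) source(1)[OF that(1)] source(1)[OF that(2)]
      unfolding proper_edge_coloring_def g_def by blast
  qed
  have g_matching: "g x = g y" if xy: "{x, y} \<in> M" for x y
  proof -
    obtain e where "e \<in> edges X" "F e = {x, y}"
      using matching_edgeE[OF xy] .
    then show ?thesis by (simp add: g_def source_eq)
  qed
  have "proper_edge_coloring Y col"
  proof (rule proper_edge_coloringI[OF card_edge_Y])
    fix x y z
    assume E: "{x, y} \<in> edges Y" "{x, z} \<in> edges Y" and neq: "x \<noteq> y" "x \<noteq> z" "y \<noteq> z"
    \<comment> \<open>If one of the edges lies in \<open>M\<close>, its other end has the same index
      as \<open>x\<close>, which no other member of the cluster of \<open>x\<close> has.\<close>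
    have "g y \<noteq> g z"
    proof (cases "{x, y} \<in> M"; cases "{x, z} \<in> M")
      assume "{x, y} \<in> M" "{x, z} \<in> M"
      then show ?thesis
        using matching_disjoint[of "{x, y}" "{x, z}" x] neq by (auto simp: doubleton_eq_iff)
    next
      assume "{x, y} \<in> M" "{x, z} \<notin> M"
      then show ?thesis
        using g_matching[of x y] constituent_edge[OF E(2)] g_inj[of x z] neq by auto
    next
      assume "{x, y} \<notin> M" "{x, z} \<in> M"
      then show ?thesis
        using g_matching[of x z] constituent_edge[OF E(1)] g_inj[of x y] neq by auto
    next
      assume "{x, y} \<notin> M" "{x, z} \<notin> M"
      then show ?thesis
        using constituent_edge[OF E(1)] constituent_edge[OF E(2)] g_inj[of y z] neq by auto
    qed
    moreover have "g y < max_valency X" "g z < max_valency X"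
      using g_less edge_Y_subset[OF E(1)] edge_Y_subset[OF E(2)] by auto
    ultimately show "col {x, y} \<noteq> col {x, z}"
      using add_mod_cancel_left_nat[of "g x" "g y" "max_valency X" "g z"] neq by (auto simp: col_def)
  qed
  moreover have "col ` edges Y \<subseteq> {..<max_valency X}"
  proof
    fix k assume "k \<in> col ` edges Y"
    then obtain E where E: "E \<in> edges Y" "k = col E" by blast
    then have "E \<noteq> {}" using card_edge_Y[OF E(1)] by auto
    then obtain x where "x \<in> E" by blast
    \<comment> \<open>Reduction modulo 0 would bound nothing; the index of an end of
      \<open>E\<close> shows that the modulus is positive.\<close>
    then have "g x < max_valency X"
      using g_less edge_Y_subset[OF E(1)] by blast
    then have "0 < max_valency X" by simp
    then show "k \<in> {..<max_valency X}" by (simp add: E(2) col_def)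
  qed
  ultimately show ?thesis by (rule class_I_Y_of_coloring)
qed

section \<open>Colouring \<open>Y\<close> when the maximum valency is even\<close>

lemma cluster_index_exists:
  "\<exists>g. (\<forall>x\<in>\<Union>M. g x < max_valency X) \<and>
       (\<forall>x\<in>\<Union>M. \<forall>y\<in>\<Union>M. lab x = lab y \<and> x \<noteq> y \<longrightarrow> g x \<noteq> g y)"
proof -
  \<comment> \<open>A cluster has at most \<open>max_valency X\<close> members, so it can be indexed
    injectively. The choices for different clusters are independent and are glued along
    \<open>lab\<close>.\<close>
  have "\<exists>h. inj_on h (cluster M lab v) \<and> h ` cluster M lab v \<subseteq> {..<max_valency X}"
    if "v \<in> verts X" for v
  proof -
    have "card (cluster M lab v) \<le> card {..<max_valency X}"
      using valency_le_max_valency[OF finite_verts that] by (simp add: card_cluster)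
    then show ?thesis
      using card_le_inj[OF finite_cluster] by blast
  qed
  then obtain h where h: "\<And>v. v \<in> verts X \<Longrightarrow>
      inj_on (h v) (cluster M lab v) \<and> h v ` cluster M lab v \<subseteq> {..<max_valency X}"
    by metis
  have lab: "lab x \<in> verts X" "x \<in> cluster M lab (lab x)" if "x \<in> \<Union>M" for x
    using source(3)[OF that] edge_subset[OF source(1)[OF that]] that by (auto simp: cluster_def)
  show ?thesis
  proof (intro exI conjI ballI impI)
    fix x assume "x \<in> \<Union>M"
    then show "h (lab x) x < max_valency X"
      using h[OF lab(1), of x] lab(2)[of x] by (simp add: image_subset_iff)
  next
    fix x y assume "x \<in> \<Union>M" "y \<in> \<Union>M" "lab x = lab y \<and> x \<noteq> y"
    then have "inj_on (h (lab x)) (cluster M lab (lab x))"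
        "x \<in> cluster M lab (lab x)" "y \<in> cluster M lab (lab x)" "x \<noteq> y" "lab x = lab y"
      using h[OF lab(1), of x] lab(2)[of x] lab(2)[of y] by simp_all
    then show "h (lab x) x \<noteq> h (lab y) y"
      by (metis inj_onD)
  qed
qed

lemma class_I_Y_if_even:
  assumes "even (max_valency X)"
  shows "class_I Y"
proof -
  obtain g where g: "\<forall>x\<in>\<Union>M. g x < max_valency X"
      "\<forall>x\<in>\<Union>M. \<forall>y\<in>\<Union>M. lab x = lab y \<and> x \<noteq> y \<longrightarrow> g x \<noteq> g y"
    using cluster_index_exists by (elim exE conjE)
  have g_less: "g x < max_valency X" if "x \<in> \<Union>M" for x
    using g(1) that by (rule bspec)
  have g_inj: "g x \<noteq> g y" if "x \<in> \<Union>M" "y \<in> \<Union>M" "lab x = lab y" "x \<noteq> y" for x y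
    using bspec[OF bspec[OF g(2) that(1)] that(2)] that(3,4) by simp
  define n where "n = max_valency X - 1"
  \<comment> \<open>The index \<open>n\<close> is the point at infinity of the 1-factorization: being \<open>0\<close> modulo \<open>n\<close>, it
    drops out of the doubled sum, so that the edge from \<open>a\<close> to \<open>n\<close> gets the colour \<open>2 * a\<close>
    that the rule \<open>a + b\<close> leaves free at \<open>a\<close>.\<close>
  define col where "col E =
    (if E \<in> M then n else (if n \<in> g ` E then 2 * sum g E else sum g E) mod n)" for E
  \<comment> \<open>Evenness alone allows \<open>max_valency X = 0\<close>, where the subtraction in
    \<open>n\<close> truncates; a vertex of \<open>Y\<close> rules this out.\<close>
  have n: "max_valency X = Suc n" "odd n" if "x \<in> \<Union>M" for x
  proof -
    show "max_valency X = Suc n" using g_less[OF that] by (simp add: n_def)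
    then show "odd n" using assms by simp
  qed
  \<comment> \<open>Constituent edges use only residues modulo \<open>n\<close>, so the colour
    \<open>n\<close> is reserved for \<open>M\<close>.\<close>
  have col_less: "col {x, y} < n" if "{x, y} \<in> edges Y" "{x, y} \<notin> M" for x y
    using n(2)[OF constituent_edge(1)[OF that]] that by (auto simp: col_def odd_pos)
  have "proper_edge_coloring Y col"
  proof (rule proper_edge_coloringI[OF card_edge_Y])
    fix x y z
    assume E: "{x, y} \<in> edges Y" "{x, z} \<in> edges Y" and neq: "x \<noteq> y" "x \<noteq> z" "y \<noteq> z"
    show "col {x, y} \<noteq> col {x, z}"
    proof (cases "{x, y} \<in> M"; cases "{x, z} \<in> M")
      assume "{x, y} \<in> M" "{x, z} \<in> M"
      then show ?thesis
        using matching_disjoint[of "{x, y}" "{x, z}" x] neq by (auto simp: doubleton_eq_iff)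
    next
      assume "{x, y} \<in> M" "{x, z} \<notin> M"
      then show ?thesis using col_less[OF E(2)] by (simp add: col_def)
    next
      assume "{x, y} \<notin> M" "{x, z} \<in> M"
      then show ?thesis using col_less[OF E(1)] by (simp add: col_def)
    next
      assume notM: "{x, y} \<notin> M" "{x, z} \<notin> M"
      note xy = constituent_edge[OF E(1) notM(1)] and xz = constituent_edge[OF E(2) notM(2)]
      note n = n[OF xy(1)]
      have distinct: "g x \<noteq> g y" "g x \<noteq> g z" "g y \<noteq> g z"
        using g_inj[of x y] g_inj[of x z] g_inj[of y z] xy xz neq by auto
      have le: "g x \<le> n" "g y \<le> n" "g z \<le> n"
        using g_less[OF xy(1)] g_less[OF xy(2)] g_less[OF xz(2)] n(1) by simp_all
      have col_infinity: "col {u, w} = (g w + g w) mod n"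
        if "{u, w} \<notin> M" "u \<noteq> w" "g u = n" for u w
      proof -
        have "sum g {u, w} = g w + n" "n \<in> g ` {u, w}" using that by auto
        then have "col {u, w} = (2 * (g w + n)) mod n" using that(1) by (simp add: col_def)
        also have "2 * (g w + n) = (g w + g w) + 2 * n" by simp
        finally show ?thesis by (simp only: mod_mult_self1)
      qed
      have col_finite: "col {u, w} = (g u + g w) mod n"
        if "{u, w} \<notin> M" "u \<noteq> w" "g u \<noteq> n" "g w \<noteq> n" for u w
        using that by (auto simp: col_def)
      consider "g x = n" | "g y = n" | "g z = n" | "g x < n" "g y < n" "g z < n"
        using le by linarith
      then show ?thesis
      proof cases
        case 1
        \<comment> \<open>Here the parity enters: as \<open>n\<close> is odd, 2 can be cancelled
          modulo \<open>n\<close>, and \<open>g y\<close> and \<open>g z\<close> are distinct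
          residues below \<open>n\<close>.\<close>
        have "[2 * g y \<noteq> 2 * g z] (mod n)"
        proof
          assume "[2 * g y = 2 * g z] (mod n)"
          then have "[g y = g z] (mod n)"
            using n(2) by (simp add: cong_mult_lcancel_nat coprime_commute)
          then show False
            using 1 distinct le by (simp add: cong_def)
        qed
        then show ?thesis
          using col_infinity[OF notM(1) neq(1) 1] col_infinity[OF notM(2) neq(2) 1]
          unfolding cong_def mult_2 by simp
      next
        \<comment> \<open>Equal colours would give \<open>g z = g x\<close> after cancelling one
          \<open>g x\<close>, since both indices lie below \<open>n\<close>.\<close>
        case 2
        then have "col {x, y} = (g x + g x) mod n" "col {x, z} = (g x + g z) mod n"
          using col_infinity[of y x] col_finite[of x z] notM neq distinct
          by (simp_all add: insert_commute)
        then show ?thesis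
          using add_mod_cancel_left_nat[of "g x" "g x" n "g z"] distinct le 2 by fastforce
      next
        case 3
        then have "col {x, z} = (g x + g x) mod n" "col {x, y} = (g x + g y) mod n"
          using col_infinity[of z x] col_finite[of x y] notM neq distinct
          by (simp_all add: insert_commute)
        then show ?thesis
          using add_mod_cancel_left_nat[of "g x" "g y" n "g x"] distinct le 3 by fastforce
      next
        case 4
        then show ?thesis
          using add_mod_cancel_left_nat[of "g x" "g y" n "g z"] distinct(3)
            col_finite[OF notM(1) neq(1)] col_finite[OF notM(2) neq(2)]
          by auto
      qed
    qed
  qed
  moreover have "col ` edges Y \<subseteq> {..<max_valency X}"
  proof
    fix k assume "k \<in> col ` edges Y"
    then obtain E where E: "E \<in> edges Y" "k = col E" by blast
    then obtain x y where xy: "E = {x, y}"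
      using card_edge_Y by (metis card_2_iff)
    have "k \<le> n"
      using E col_less[of x y] xy by (cases "E \<in> M") (auto simp: col_def)
    then show "k \<in> {..<max_valency X}"
      using n(1)[of x] edge_Y_subset[OF E(1)] xy by auto
  qed
  ultimately show ?thesis by (rule class_I_Y_of_coloring)
qed

end

theorem theorem7p1:
  fixes X :: "'a ugraph" and Y :: "'b ugraph"
  assumes "finite_simple_graph X"
    and "\<nexists>v. isolated_vertex X v"
    and "complete_generalized_truncation X Y"
  shows "(class_I X \<longrightarrow> class_I Y) \<and>
         (class_II X \<and> even (max_valency X) \<longrightarrow> class_I Y)"
proof -
  obtain M F lab con where "truncation_data X M F lab con Y"
      "\<forall>v\<in>verts X. complete_graph (con v)"
    using assms(3) unfolding complete_generalized_truncation_def by blast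
  then interpret complete_truncation X M F lab con Y
    using assms(1) by unfold_locales auto
  show ?thesis
    using class_I_Y_if_class_I class_I_Y_if_even by blast
qed

end
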